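(* Let $a,b,n$ be positive integers with $1\le a<b$, and let $G$ be a finite simple graph with minimum degree $\delta(G)\geq a+n$ and isolated toughness $I(G)\geq a-1+\frac{a+2n-1}{b}$. Then for every matching $M$ of $G$ with $|M|=n$, the graph $G-M$ has an $[a,b]$-factor.
   Context: For a graph $G$ and $S\subseteq V(G)$, $i(G-S)$ denotes the number of isolated vertices of $G-S$. The isolated toughness of $G$ is $I(G)=\min\{|S|/i(G-S): S\subseteq V(G),\ i(G-S)\geq 2\}$ if $G$ is not complete, and $I(G)=|V(G)|-1$ if $G$ is complete. A spanning subgraph $H$ of $G$ is an $[a,b]$-factor if $a\le d_H(x)\le b$ for every $x\in V(G)$. $G-M$ denotes the graph obtained by deleting the edges of $M$ (keeping all vertices). *)

theory Defs
  imports Complex_Main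
begin

text \<open>A graph is a vertex set \<open>V\<close> together with a set \<open>E\<close> of two-element subsets of \<open>V\<close>.\<close>

definition finite_simple_graph :: "'a set \<Rightarrow> 'a set set \<Rightarrow> bool" where
  "finite_simple_graph V E \<longleftrightarrow> finite V \<and> (\<forall>e\<in>E. e \<subseteq> V \<and> card e = 2)"

definition degree :: "'a set set \<Rightarrow> 'a \<Rightarrow> nat" where
  "degree E v = card {e \<in> E. v \<in> e}"

text \<open>Unspecified if \<open>V = {}\<close>.\<close>

definition min_degree :: "'a set \<Rightarrow> 'a set set \<Rightarrow> nat" where
  "min_degree V E = Min (degree E ` V)"

definition complete_graph :: "'a set \<Rightarrow> 'a set set \<Rightarrow> bool" where
  "complete_graph V E \<longleftrightarrow> (\<forall>u\<in>V. \<forall>v\<in>V. u \<noteq> v \<longrightarrow> {u, v} \<in> E)"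

definition isolated_vertices :: "'a set \<Rightarrow> 'a set set \<Rightarrow> 'a set" where
  "isolated_vertices V E = {v \<in> V. degree E v = 0}"

text \<open>For \<open>S \<subseteq> V\<close>, the graph \<open>G - S\<close> has vertex set \<open>V - S\<close> and the edges avoiding \<open>S\<close>.\<close>

definition edges_avoiding :: "'a set set \<Rightarrow> 'a set \<Rightarrow> 'a set set" where
  "edges_avoiding E S = {e \<in> E. e \<inter> S = {}}"

definition isolated_after_removal :: "'a set \<Rightarrow> 'a set set \<Rightarrow> 'a set \<Rightarrow> nat" where
  "isolated_after_removal V E S = card (isolated_vertices (V - S) (edges_avoiding E S))"

definition isolated_toughness :: "'a set \<Rightarrow> 'a set set \<Rightarrow> real" where
  "isolated_toughness V E =
    (if complete_graph V E then real (card V) - 1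
     else Min {real (card S) / real (isolated_after_removal V E S) | S.
                 S \<subseteq> V \<and> isolated_after_removal V E S \<ge> 2})"

text \<open>The minimum above ranges over a finite nonempty set:\<close>

lemma isolated_toughness_set_finite:
  assumes "finite_simple_graph V E"
  shows "finite {real (card S) / real (isolated_after_removal V E S) | S.
                   S \<subseteq> V \<and> isolated_after_removal V E S \<ge> 2}"
  using assms by (simp add: finite_simple_graph_def)

lemma isolated_toughness_set_nonempty:
  assumes G: "finite_simple_graph V E" and nc: "\<not> complete_graph V E"
  shows "{real (card S) / real (isolated_after_removal V E S) | S.
            S \<subseteq> V \<and> isolated_after_removal V E S \<ge> 2} \<noteq> {}"
proof -
  obtain u v where uv: "u \<in> V" "v \<in> V" "u \<noteq> v" "{u, v} \<notin> E"
    using nc by (auto simp: complete_graph_def)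
  let ?S = "V - {u, v}"
  have "edges_avoiding E ?S = {}"
  proof (rule ccontr)
    assume "edges_avoiding E ?S \<noteq> {}"
    then obtain e where e: "e \<in> E" "e \<inter> ?S = {}"
      by (auto simp: edges_avoiding_def)
    then have "e \<subseteq> {u, v}" "card e = card {u, v}"
      using G uv by (auto simp: finite_simple_graph_def)
    then have "e = {u, v}"
      by (simp add: card_subset_eq)
    then show False
      using e uv by simp
  qed
  moreover have "V - ?S = {u, v}"
    using uv by auto
  ultimately have "isolated_vertices (V - ?S) (edges_avoiding E ?S) = {u, v}"
    by (auto simp: isolated_vertices_def degree_def)
  then have "isolated_after_removal V E ?S = 2"
    using uv by (simp add: isolated_after_removal_def)
  then have "?S \<subseteq> V \<and> isolated_after_removal V E ?S \<ge> 2"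
    by auto
  then show ?thesis
    by blast
qed

definition matching :: "'a set set \<Rightarrow> 'a set set \<Rightarrow> bool" where
  "matching E M \<longleftrightarrow> M \<subseteq> E \<and> (\<forall>e\<in>M. \<forall>f\<in>M. e \<noteq> f \<longrightarrow> e \<inter> f = {})"

text \<open>A spanning subgraph is determined by its edge set \<open>F\<close>.\<close>

definition is_ab_factor :: "nat \<Rightarrow> nat \<Rightarrow> 'a set \<Rightarrow> 'a set set \<Rightarrow> 'a set set \<Rightarrow> bool" where
  "is_ab_factor a b V E F \<longleftrightarrow> F \<subseteq> E \<and> (\<forall>x\<in>V. a \<le> degree F x \<and> degree F x \<le> b)"

definition has_ab_factor :: "nat \<Rightarrow> nat \<Rightarrow> 'a set \<Rightarrow> 'a set set \<Rightarrow> bool" where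
  "has_ab_factor a b V E \<longleftrightarrow> (\<exists>F. is_ab_factor a b V E F)"

end

theory Submission
  imports Defs
begin

text \<open>If \<open>G - M\<close> has no \<open>[a,b]\<close>-factor, the factor criterion for \<open>a < b\<close> (proved by alternating
  trails, where the gap between the bounds removes all parity conditions) yields disjoint \<open>S\<close>, \<open>T\<close>
  with \<open>b |S| < \<Sum>\<^sub>T (a - d\<^bsub>G-M-S\<^esub>) \<le> \<Sum>\<^sub>U (a - d) + 2n\<close>, where \<open>d\<close> is the degree in \<open>G - S\<close> and \<open>U\<close>
  consists of the vertices with \<open>d < a\<close>. Choosing vertices of smallest \<open>d\<close> greedily gives an
  independent set \<open>I \<subseteq> U\<close> with \<open>\<Sum>\<^sub>U (a - d) \<le> \<Sum>\<^sub>I (d + 1) (a - d) \<le> \<Sum>\<^sub>I (b (a - 1 - d) + a)\<close>.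
  If \<open>|I| \<ge> 2\<close>, deleting \<open>S\<close> and the neighbours of \<open>I\<close> isolates \<open>I\<close>, and isolated toughness gives
  \<open>b |S| \<ge> \<Sum>\<^sub>I (b (a - 1 - d) + a + 2n - 1)\<close>, which is too large. If \<open>|I| \<le> 1\<close>, the minimum degree
  bounds \<open>|S|\<close> from below.\<close>

subsection \<open>Degrees\<close>

lemma finite_simple_graph_finite_edges:
  assumes "finite_simple_graph V E"
  shows "finite E"
proof (rule finite_subset)
  show "E \<subseteq> Pow V" using assms by (auto simp: finite_simple_graph_def)
  show "finite (Pow V)" using assms by (simp add: finite_simple_graph_def)
qed

lemma finite_simple_graph_subset:
  "finite_simple_graph V E \<Longrightarrow> F \<subseteq> E \<Longrightarrow> finite_simple_graph V F"
  by (auto simp: finite_simple_graph_def)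

lemma finite_simple_graph_edgeD:
  assumes "finite_simple_graph V E" "{x, y} \<in> E"
  shows "x \<in> V" "y \<in> V" "x \<noteq> y"
  using assms by (auto simp: finite_simple_graph_def)

lemma finite_simple_graph_edge_at:
  assumes "finite_simple_graph V E" "e \<in> E" "x \<in> e"
  obtains y where "e = {x, y}" "x \<noteq> y"
proof -
  have "card e = 2" using assms by (simp add: finite_simple_graph_def)
  then obtain p q where "e = {p, q}" "p \<noteq> q" by (auto simp: card_2_iff)
  then show thesis using assms(3) that[of p] that[of q] by (auto simp: insert_commute)
qed

lemma edges_avoiding_subset: "edges_avoiding E S \<subseteq> E"
  by (auto simp: edges_avoiding_def)

lemma degree_mono: "finite F \<Longrightarrow> E \<subseteq> F \<Longrightarrow> degree E x \<le> degree F x"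
  unfolding degree_def by (rule card_mono) auto

lemma degree_Un_le: "degree (E \<union> F) x \<le> degree E x + degree F x"
proof -
  have "{e \<in> E \<union> F. x \<in> e} = {e \<in> E. x \<in> e} \<union> {e \<in> F. x \<in> e}" by auto
  then show ?thesis unfolding degree_def by (simp add: card_Un_le)
qed

lemma degree_insert:
  assumes "finite E" "e \<notin> E"
  shows "degree (insert e E) x = degree E x + of_bool (x \<in> e)"
proof -
  have "{f \<in> insert e E. x \<in> f} = (if x \<in> e then insert e {f \<in> E. x \<in> f} else {f \<in> E. x \<in> f})"
    by auto
  then show ?thesis using assms by (simp add: degree_def)
qed

lemma degree_remove:
  assumes "finite E" "e \<in> E"
  shows "degree E x = degree (E - {e}) x + of_bool (x \<in> e)"
  using degree_insert[of "E - {e}" e x] assms by (simp add: insert_absorb)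

lemma degree_eq_card_neighbours:
  assumes "finite_simple_graph V E"
  shows "degree E x = card {y. {x, y} \<in> E}"
proof -
  have "{e \<in> E. x \<in> e} = (\<lambda>y. {x, y}) ` {y. {x, y} \<in> E}"
    using finite_simple_graph_edge_at[OF assms] by (auto simp: image_iff) metis
  moreover have "inj_on (\<lambda>y. {x, y}) {y. {x, y} \<in> E}"
    by (auto simp: inj_on_def doubleton_eq_iff)
  ultimately show ?thesis by (simp add: degree_def card_image)
qed

lemma finite_neighbours:
  assumes "finite_simple_graph V E"
  shows "finite {y. {x, y} \<in> E}"
proof (rule finite_subset)
  show "{y. {x, y} \<in> E} \<subseteq> V" using assms by (auto simp: finite_simple_graph_def)
  show "finite V" using assms by (simp add: finite_simple_graph_def)
qed

text \<open>Double counting of incidences: each edge has at most two ends in \<open>T\<close>.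
  Applied to the matching, this produces the loss \<open>2 * n\<close>.\<close>

lemma sum_degree_le:
  assumes G: "finite_simple_graph V E" and T: "finite T"
  shows "(\<Sum>x\<in>T. degree E x) \<le> 2 * card E"
proof -
  have fE: "finite E" by (rule finite_simple_graph_finite_edges[OF G])
  have "(\<Sum>x\<in>T. degree E x) = (\<Sum>x\<in>T. \<Sum>e\<in>E. of_bool (x \<in> e))"
    using fE by (simp add: degree_def Int_def)
  also have "\<dots> = (\<Sum>e\<in>E. \<Sum>x\<in>T. of_bool (x \<in> e))" by (rule sum.swap)
  also have "\<dots> \<le> (\<Sum>e\<in>E. 2)"
  proof (rule sum_mono)
    fix e assume "e \<in> E"
    then have c: "card e = 2" using G by (simp add: finite_simple_graph_def)
    then have "finite e" by (metis card.infinite zero_neq_numeral)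
    then have "card (T \<inter> {x. x \<in> e}) \<le> card e" by (auto intro: card_mono)
    then show "(\<Sum>x\<in>T. of_bool (x \<in> e)) \<le> (2::nat)" using T c by simp
  qed
  finally show ?thesis by simp
qed

text \<open>The edges at \<open>x\<close> lost by deleting \<open>S\<close> end in distinct vertices
  of \<open>S\<close>.\<close>

lemma degree_le_edges_avoiding:
  assumes G: "finite_simple_graph V E" and S: "finite S" "x \<notin> S"
  shows "degree E x \<le> degree (edges_avoiding E S) x + card S"
proof -
  have "{y. {x, y} \<in> E} \<subseteq> {y. {x, y} \<in> edges_avoiding E S} \<union> S"
    using S by (auto simp: edges_avoiding_def)
  moreover have "finite {y. {x, y} \<in> edges_avoiding E S}"
    by (rule finite_neighbours[OF finite_simple_graph_subset[OF G edges_avoiding_subset]])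
  ultimately have "card {y. {x, y} \<in> E} \<le> card {y. {x, y} \<in> edges_avoiding E S} + card S"
    using S(1) by (meson card_Un_le card_mono finite_UnI le_trans)
  then show ?thesis
    using degree_eq_card_neighbours[OF G]
      degree_eq_card_neighbours[OF finite_simple_graph_subset[OF G edges_avoiding_subset]]
    by simp
qed

subsection \<open>Degree-constrained factors\<close>

text \<open>Trails from \<open>u\<close> alternating between edges outside and inside \<open>F\<close>, beginning outside. The flag
  is \<open>True\<close> if the next edge must lie outside \<open>F\<close>; the set collects the edges used.\<close>

inductive alt_trail :: "'a set set \<Rightarrow> 'a set set \<Rightarrow> 'a \<Rightarrow> 'a \<Rightarrow> bool \<Rightarrow> 'a set set \<Rightarrow> bool"
  for E F u where
  start: "alt_trail E F u u True {}"
| add: "alt_trail E F u x True X \<Longrightarrow> {x, y} \<in> E - F \<Longrightarrow> {x, y} \<notin> X \<Longrightarrow>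
    alt_trail E F u y False (insert {x, y} X)"
| del: "alt_trail E F u x False X \<Longrightarrow> {x, y} \<in> F \<Longrightarrow> {x, y} \<notin> X \<Longrightarrow>
    alt_trail E F u y True (insert {x, y} X)"

lemma alt_trail_edges:
  assumes "alt_trail E F u x s X" "F \<subseteq> E"
  shows "finite X \<and> X \<subseteq> E"
  using assms by (induction) auto

text \<open>Some stage of the construction appended \<open>e\<close>; the trails just before and
  just after it are \<open>Y\<close> and \<open>Z\<close>. This tells how both ends of an edge
  already used are reached.\<close>

lemma alt_trail_edgeE:
  assumes "alt_trail E F u z s X" "e \<in> X"
  obtains x y t Y Z where "e = {x, y}" "t \<longleftrightarrow> e \<notin> F"
    "alt_trail E F u x t Y" "alt_trail E F u y (\<not> t) Z"
proof -
  have "\<exists>x y Y Z. e = {x, y} \<and> alt_trail E F u x (e \<notin> F) Y \<and> alt_trail E F u y (e \<in> F) Z"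
    using assms
  proof (induction)
    case (add x X y)
    show ?case
    proof (cases "e \<in> X")
      case False
      then have "e = {x, y}" "e \<notin> F" using add by auto
      then show ?thesis using add.hyps alt_trail.add[OF add.hyps] by auto
    qed (use add.IH in blast)
  next
    case (del x X y)
    show ?case
    proof (cases "e \<in> X")
      case False
      then have "e = {x, y}" "e \<in> F" using del by auto
      then show ?thesis using del.hyps alt_trail.del[OF del.hyps] by auto
    qed (use del.IH in blast)
  qed simp
  then show thesis using that by auto
qed

text \<open>At an inner visit one edge is added and one deleted, so only the two ends of the trail
  change degree. The contributions accumulate if the ends coincide, and cancel for the empty
  trail.\<close>

lemma degree_flip_alt_trail:
  assumes "finite_simple_graph V E" "F \<subseteq> E" "alt_trail E F u x s X"
  shows "int (degree (sym_diff F X) z) =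
    int (degree F z) + of_bool (z = u) + (if s then - of_bool (z = x) else of_bool (z = x))"
  using assms(3)
proof (induction)
  case start
  show ?case by simp
next
  case (add x X y)
  have X: "finite X" using alt_trail_edges[OF add.hyps(1) assms(2)] by simp
  have F: "finite F"
    using finite_simple_graph_finite_edges[OF assms(1)] assms(2) by (rule rev_finite_subset)
  have ne: "x \<noteq> y" using finite_simple_graph_edgeD[OF assms(1)] add.hyps(2) by blast
  have "sym_diff F (insert {x, y} X) = insert {x, y} (sym_diff F X)"
    using add.hyps by auto
  moreover have "{x, y} \<notin> sym_diff F X" using add.hyps by auto
  ultimately have "degree (sym_diff F (insert {x, y} X)) z =
      degree (sym_diff F X) z + of_bool (z \<in> {x, y})"
    using X F by (simp add: degree_insert)
  then show ?case using add.IH ne by auto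
next
  case (del x X y)
  have X: "finite X" using alt_trail_edges[OF del.hyps(1) assms(2)] by simp
  have F: "finite F"
    using finite_simple_graph_finite_edges[OF assms(1)] assms(2) by (rule rev_finite_subset)
  have ne: "x \<noteq> y" using finite_simple_graph_edgeD[OF assms(1)] del.hyps(2) assms(2) by blast
  have "sym_diff F (insert {x, y} X) = sym_diff F X - {{x, y}}"
    using del.hyps by auto
  moreover have "{x, y} \<in> sym_diff F X" using del.hyps by auto
  ultimately have "degree (sym_diff F X) z =
      degree (sym_diff F (insert {x, y} X)) z + of_bool (z \<in> {x, y})"
    using X F degree_remove[of "sym_diff F X" "{x, y}" z] by simp
  then show ?case using del.IH ne by auto
qed

text \<open>Sufficiency in Lovasz's \<open>(g,f)\<close>-factor theorem when \<open>g < f\<close>.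
  Among edge sets respecting \<open>f\<close>, one with least total shortfall below \<open>g\<close>
  is taken; if a shortfall remains at \<open>u\<close>, the vertices reached by alternating trails
  from \<open>u\<close> violate \<open>cond\<close>.\<close>

theorem gf_factor_exists:
  fixes g f :: "'a \<Rightarrow> nat"
  assumes G: "finite_simple_graph V E"
    and gf: "\<And>x. x \<in> V \<Longrightarrow> g x < f x"
    and cond: "\<And>S T. S \<subseteq> V \<Longrightarrow> T \<subseteq> V \<Longrightarrow> S \<inter> T = {} \<Longrightarrow>
      (\<Sum>x\<in>T. g x) \<le> (\<Sum>x\<in>S. f x) + (\<Sum>x\<in>T. degree (edges_avoiding E S) x)"
  shows "\<exists>F\<subseteq>E. \<forall>x\<in>V. g x \<le> degree F x \<and> degree F x \<le> f x"
proof -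
  define feasible where "feasible F \<longleftrightarrow> F \<subseteq> E \<and> (\<forall>x\<in>V. degree F x \<le> f x)" for F
  \<comment> \<open>Subtraction is truncated: surplus above \<open>g\<close> at one vertex cannot
    offset a shortfall at another.\<close>
  define deficiency where "deficiency F = (\<Sum>x\<in>V. g x - degree F x)" for F
  have fV: "finite V" using G by (simp add: finite_simple_graph_def)
  have fE: "finite E" by (rule finite_simple_graph_finite_edges[OF G])
  have "feasible {}" by (simp add: feasible_def degree_def)
  then obtain F where F: "feasible F" and opt: "\<And>H. feasible H \<Longrightarrow> deficiency F \<le> deficiency H"
    using ex_has_least_nat[of feasible "{}" deficiency] by blast
  have FE: "F \<subseteq> E" and Ff: "\<And>x. x \<in> V \<Longrightarrow> degree F x \<le> f x" using F by (auto simp: feasible_def)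
  have fF: "finite F" using fE FE by (rule rev_finite_subset)
  have "g u \<le> degree F u" if u: "u \<in> V" for u
  proof (rule ccontr)
    assume "\<not> g u \<le> degree F u"
    then have du: "degree F u < g u" by simp
    have inV: "x \<in> V" if "alt_trail E F u x s X" for x s X
      using that by cases (use u FE finite_simple_graph_edgeD[OF G] in blast)+
    text \<open>By optimality, flipping a trail never makes a better feasible set. For a trail returning
      to \<open>u\<close> along an added edge, \<open>u\<close> gains two edges, which is allowed since \<open>g u < f u\<close>.\<close>
    have no_gain: "if s then degree F x \<le> g x else f x \<le> degree F x"
      if tr: "alt_trail E F u x s X" for x s X
    proof (rule ccontr)
      assume bad: "\<not> ?thesis"
      let ?H = "sym_diff F X"
      have deg: "int (degree ?H z) = int (degree F z) + of_bool (z = u)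
          + (if s then - of_bool (z = x) else of_bool (z = x))" for z
        by (rule degree_flip_alt_trail[OF G FE tr])
      have "?H \<subseteq> E" using alt_trail_edges[OF tr FE] FE by auto
      moreover have "degree ?H z \<le> f z" if "z \<in> V" for z
        using deg[of z] bad du Ff[OF that] gf[OF that] by (auto simp: of_bool_def split: if_splits)
      ultimately have "feasible ?H" by (simp add: feasible_def)
      moreover have "deficiency ?H < deficiency F"
        unfolding deficiency_def
      proof (rule sum_strict_mono_ex1[OF fV])
        show "\<forall>z\<in>V. g z - degree ?H z \<le> g z - degree F z"
        proof
          fix z
          show "g z - degree ?H z \<le> g z - degree F z"
            using deg[of z] bad du by (auto simp: of_bool_def split: if_splits)
        qed
        have "g u - degree ?H u < g u - degree F u"
          using deg[of u] bad du by (auto simp: of_bool_def split: if_splits)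
        then show "\<exists>z\<in>V. g z - degree ?H z < g z - degree F z" using u by blast
      qed
      ultimately show False using opt by fastforce
    qed
    \<comment> \<open>By \<open>no_gain\<close>, degrees in \<open>F\<close> are at most
      \<open>g\<close> on \<open>T\<close> and at least \<open>f\<close> on \<open>S\<close>. The
      gap \<open>g < f\<close> therefore keeps the two sets disjoint.\<close>
    define T where "T = {x. \<exists>X. alt_trail E F u x True X}"
    define S where "S = {x. \<exists>X. alt_trail E F u x False X}"
    have TV: "T \<subseteq> V" and SV: "S \<subseteq> V" using inV by (auto simp: T_def S_def)
    have Tg: "degree F x \<le> g x" if "x \<in> T" for x using that no_gain by (fastforce simp: T_def)
    have Sf: "f x \<le> degree F x" if "x \<in> S" for x using that no_gain by (fastforce simp: S_def)
    have disj: "S \<inter> T = {}" using Tg Sf gf TV by fastforce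
    have uT: "u \<in> T" using alt_trail.start[of E F u] by (auto simp: T_def)
    have T_step: "y \<in> S" if xy: "x \<in> T" "{x, y} \<in> E" "{x, y} \<notin> F" for x y
    proof -
      obtain X where X: "alt_trail E F u x True X" using xy by (auto simp: T_def)
      show ?thesis
      proof (cases "{x, y} \<in> X")
        \<comment> \<open>The trail already crossed this edge, from its end in \<open>T\<close> to
          its end in \<open>S\<close>. Disjointness rules out that \<open>x\<close> is the
          latter.\<close>
        case True
        with X obtain p q t Y Z where "{x, y} = {p, q}" "t \<longleftrightarrow> {x, y} \<notin> F"
          "alt_trail E F u p t Y" "alt_trail E F u q (\<not> t) Z"
          by (rule alt_trail_edgeE)
        with xy(3) have "{x, y} = {p, q}" "p \<in> T" "q \<in> S" by (auto simp: T_def S_def)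
        then show ?thesis using disj xy(1) by (auto simp: doubleton_eq_iff)
      next
        case False
        then show ?thesis using alt_trail.add[OF X] xy by (auto simp: S_def)
      qed
    qed
    have S_step: "y \<in> T" if xy: "x \<in> S" "{x, y} \<in> F" for x y
    proof -
      obtain X where X: "alt_trail E F u x False X" using xy by (auto simp: S_def)
      show ?thesis
      proof (cases "{x, y} \<in> X")
        case True
        with X obtain p q t Y Z where "{x, y} = {p, q}" "t \<longleftrightarrow> {x, y} \<notin> F"
          "alt_trail E F u p t Y" "alt_trail E F u q (\<not> t) Z"
          by (rule alt_trail_edgeE)
        with xy(2) have "{x, y} = {p, q}" "p \<in> S" "q \<in> T" by (auto simp: T_def S_def)
        then show ?thesis using disj xy(1) by (auto simp: doubleton_eq_iff)
      next
        case False
        then show ?thesis using alt_trail.del[OF X] xy by (auto simp: T_def)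
      qed
    qed
    have GF: "finite_simple_graph V F" by (rule finite_simple_graph_subset[OF G FE])
    have fS: "finite S" and fT: "finite T" using SV TV fV by (auto intro: finite_subset)
    let ?toS = "\<lambda>x. card {y \<in> S. {x, y} \<in> F}"
    \<comment> \<open>By \<open>T_step\<close>, every edge from \<open>x\<close> that avoids
      \<open>S\<close> lies in \<open>F\<close>; the other \<open>F\<close>-edges at
      \<open>x\<close> are those counted by \<open>?toS\<close>.\<close>
    have degT: "degree (edges_avoiding E S) x + ?toS x = degree F x" if "x \<in> T" for x
    proof -
      have "{y. {x, y} \<in> edges_avoiding E S} = {y. {x, y} \<in> F} - {y \<in> S. {x, y} \<in> F}"
        using T_step[OF that] that disj FE by (auto simp: edges_avoiding_def)
      moreover have "{y \<in> S. {x, y} \<in> F} \<subseteq> {y. {x, y} \<in> F}" by auto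
      ultimately show ?thesis
        using degree_eq_card_neighbours[OF GF, of x] finite_neighbours[OF GF, of x] fS
          degree_eq_card_neighbours[OF finite_simple_graph_subset[OF G edges_avoiding_subset], of S x]
        by (simp add: card_Diff_subset card_mono)
    qed
    \<comment> \<open>By \<open>S_step\<close> all \<open>F\<close>-edges at \<open>S\<close> lead
      to \<open>T\<close>, so they can be counted from the side of \<open>T\<close>. The later
      strict inequality comes from the shortfall at \<open>u\<close>.\<close>
    have "(\<Sum>x\<in>S. f x) \<le> (\<Sum>x\<in>S. degree F x)" by (rule sum_mono) (rule Sf)
    also have "\<dots> = (\<Sum>x\<in>S. \<Sum>y\<in>T. of_bool ({x, y} \<in> F))"
    proof (rule sum.cong[OF refl])
      fix x assume "x \<in> S"
      then have "{y. {x, y} \<in> F} = T \<inter> {y. {x, y} \<in> F}" using S_step by auto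
      then show "degree F x = (\<Sum>y\<in>T. of_bool ({x, y} \<in> F))"
        using fT by (simp add: degree_eq_card_neighbours[OF GF])
    qed
    also have "\<dots> = (\<Sum>y\<in>T. \<Sum>x\<in>S. of_bool ({x, y} \<in> F))" by (rule sum.swap)
    also have "\<dots> = (\<Sum>y\<in>T. ?toS y)"
      using fS by (simp add: Int_def insert_commute)
    finally have "(\<Sum>x\<in>S. f x) + (\<Sum>x\<in>T. degree (edges_avoiding E S) x) \<le> (\<Sum>x\<in>T. degree F x)"
      using sum.cong[OF refl degT, of T "\<lambda>x. x"] by (simp add: sum.distrib)
    also have "\<dots> < (\<Sum>x\<in>T. g x)"
      by (rule sum_strict_mono_ex1[OF fT]) (use Tg uT du in auto)
    finally show False using cond[OF SV TV disj] by simp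
  qed
  then show ?thesis using FE Ff by blast
qed

subsection \<open>Independent sets and isolated toughness\<close>

text \<open>Greedy choice: a vertex of largest weight pays for its closed neighbourhood.\<close>

lemma weighted_independent_set:
  fixes w :: "'a \<Rightarrow> nat"
  assumes G: "finite_simple_graph V E" and "finite T"
  shows "\<exists>I\<subseteq>T. (\<forall>x\<in>I. \<forall>y\<in>I. {x, y} \<notin> E) \<and> (\<Sum>x\<in>T. w x) \<le> (\<Sum>x\<in>I. (degree E x + 1) * w x)"
  using assms(2)
proof (induction T rule: finite_psubset_induct)
  case (psubset T)
  show ?case
  proof (cases "T = {}")
    case False
    then have "Max (w ` T) \<in> w ` T" using psubset.hyps by simp
    then obtain x where x: "x \<in> T" and "w x = Max (w ` T)" by auto
    then have mx: "w y \<le> w x" if "y \<in> T" for y using that psubset.hyps by simp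
    define N where "N = insert x {y. {x, y} \<in> E}"
    have xN: "x \<in> N" by (simp add: N_def)
    have fN: "finite N" using finite_neighbours[OF G] by (simp add: N_def)
    have "x \<notin> {y. {x, y} \<in> E}" using finite_simple_graph_edgeD[OF G, of x x] by auto
    then have cN: "card N = degree E x + 1"
      using finite_neighbours[OF G] by (simp add: N_def degree_eq_card_neighbours[OF G])
    have "T - N \<subset> T" using x xN by auto
    from psubset.IH[OF this] obtain I where I: "I \<subseteq> T - N" "\<forall>x\<in>I. \<forall>y\<in>I. {x, y} \<notin> E"
      "(\<Sum>x\<in>T - N. w x) \<le> (\<Sum>x\<in>I. (degree E x + 1) * w x)"
      by blast
    have fI: "finite I" and xI: "x \<notin> I"
      using I(1) psubset.hyps xN by (auto intro: finite_subset)
    have "\<forall>y\<in>insert x I. \<forall>z\<in>insert x I. {y, z} \<notin> E"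
    proof (intro ballI notI)
      fix y z assume yz: "y \<in> insert x I" "z \<in> insert x I" "{y, z} \<in> E"
      have "z \<notin> I" if "y = x" using that I(1) yz(3) by (auto simp: N_def)
      moreover have "y \<notin> I" if "z = x"
        using that I(1) yz(3) insert_commute[of y x] by (auto simp: N_def)
      ultimately show False using yz I(2) finite_simple_graph_edgeD(3)[OF G yz(3)] by blast
    qed
    moreover have "(\<Sum>y\<in>T. w y) \<le> (\<Sum>y\<in>insert x I. (degree E y + 1) * w y)"
    proof -
      have "(\<Sum>y\<in>T. w y) = (\<Sum>y\<in>T - N. w y) + (\<Sum>y\<in>T \<inter> N. w y)"
        using psubset.hyps by (metis sum.Int_Diff add.commute)
      moreover have "(\<Sum>y\<in>T \<inter> N. w y) \<le> card (T \<inter> N) * w x"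
        using sum_bounded_above[of "T \<inter> N" w "w x"] mx by simp
      moreover have "card (T \<inter> N) * w x \<le> (degree E x + 1) * w x"
        unfolding cN[symmetric] using fN by (intro mult_right_mono card_mono) auto
      ultimately show ?thesis using I(3) fI xI by simp
    qed
    ultimately show ?thesis using I(1) x by (intro exI[of _ "insert x I"]) auto
  qed simp
qed

text \<open>Deleting \<open>S\<close> and all neighbours of \<open>I\<close> isolates
  \<open>I\<close>, and the deleted set has at most as many vertices as the right-hand side. Two
  nonadjacent vertices in \<open>I\<close> ensure that the graph is not complete.\<close>

lemma isolated_toughness_le:
  assumes G: "finite_simple_graph V E" and S: "S \<subseteq> V"
    and I: "I \<subseteq> V - S" "\<forall>x\<in>I. \<forall>y\<in>I. {x, y} \<notin> E" "2 \<le> card I"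
    and t0: "0 \<le> t" and t: "t \<le> isolated_toughness V E"
  shows "t * real (card I) \<le> real (card S) + (\<Sum>x\<in>I. real (degree (edges_avoiding E S) x))"
proof -
  let ?N = "\<lambda>x. {y. {x, y} \<in> edges_avoiding E S}"
  have GS: "finite_simple_graph V (edges_avoiding E S)"
    by (rule finite_simple_graph_subset[OF G edges_avoiding_subset])
  have fV: "finite V" using G by (simp add: finite_simple_graph_def)
  have fI: "finite I" using I(1) fV by (meson finite_Diff finite_subset)
  define X where "X = S \<union> (\<Union>x\<in>I. ?N x)"
  have XV: "X \<subseteq> V" using S finite_simple_graph_edgeD[OF GS] by (auto simp: X_def)
  have XI: "X \<inter> I = {}" using I(1,2) by (auto simp: X_def edges_avoiding_def)
  have "degree (edges_avoiding E X) x = 0" if x: "x \<in> I" for x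
  proof -
    have "{x, y} \<notin> edges_avoiding E X" for y
      using x I(1) by (auto simp: X_def edges_avoiding_def)
    then show ?thesis
      by (simp add: degree_eq_card_neighbours[OF finite_simple_graph_subset[OF G edges_avoiding_subset]])
  qed
  then have "I \<subseteq> isolated_vertices (V - X) (edges_avoiding E X)"
    using I(1) XI by (auto simp: isolated_vertices_def)
  then have iso: "card I \<le> isolated_after_removal V E X"
    unfolding isolated_after_removal_def isolated_vertices_def using fV by (intro card_mono) auto
  obtain x y where "x \<in> I" "y \<in> I" "x \<noteq> y"
    using I(3) card_le_Suc0_iff_eq[OF fI] by auto
  then have "\<not> complete_graph V E" using I(1,2) unfolding complete_graph_def by blast
  then have "isolated_toughness V E \<le> real (card X) / real (isolated_after_removal V E X)"
    unfolding isolated_toughness_def using XV iso I(3)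
    by (auto intro!: Min_le isolated_toughness_set_finite[OF G])
  then have "t \<le> real (card X) / real (isolated_after_removal V E X)" using t by simp
  then have "t * real (isolated_after_removal V E X) \<le> real (card X)"
    using iso I(3) by (simp add: pos_le_divide_eq)
  moreover have "t * real (card I) \<le> t * real (isolated_after_removal V E X)"
    using t0 iso by (intro mult_left_mono) auto
  moreover have "card X \<le> card S + (\<Sum>x\<in>I. card (?N x))"
    unfolding X_def using card_Un_le[of S] card_UN_le[OF fI, of ?N] by (meson add_left_mono le_trans)
  then have "real (card X) \<le> real (card S) + (\<Sum>x\<in>I. real (degree (edges_avoiding E S) x))"
    by (simp add: degree_eq_card_neighbours[OF GS] flip: of_nat_sum of_nat_add)
  ultimately show ?thesis by linarith
qed

lemma degree_matching_le:
  assumes "matching E M" "finite M"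
  shows "degree M x \<le> 1"
  unfolding degree_def using assms by (auto simp: card_le_Suc0_iff_eq matching_def)

section \<open>Deleting a matching: from the factor criterion to a contradiction\<close>

theorem theorem6:
  fixes V :: "'a set" and E :: "'a set set" and a b n :: nat
  assumes "finite_simple_graph V E"
    and "1 \<le> a" and "a < b" and "1 \<le> n"
    and "min_degree V E \<ge> a + n"
    and "isolated_toughness V E \<ge> real a - 1 + (real a + 2 * real n - 1) / real b"
  shows "\<forall>M. matching E M \<and> card M = n \<longrightarrow> has_ab_factor a b V (E - M)"
proof (intro allI impI, rule ccontr)
  fix M assume M: "matching E M \<and> card M = n" and none: "\<not> has_ab_factor a b V (E - M)"
  note G = assms(1)
  have fV: "finite V" using G by (simp add: finite_simple_graph_def)
  have fE: "finite E" by (rule finite_simple_graph_finite_edges[OF G])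
  have ME: "M \<subseteq> E" using M by (simp add: matching_def)
  have fM: "finite M" using fE ME by (rule rev_finite_subset)
  have GM: "finite_simple_graph V M" by (rule finite_simple_graph_subset[OF G ME])
  have GD: "finite_simple_graph V (E - M)" by (rule finite_simple_graph_subset[OF G]) auto
  have "\<exists>S T. S \<subseteq> V \<and> T \<subseteq> V \<and> S \<inter> T = {} \<and>
    b * card S + (\<Sum>x\<in>T. degree (edges_avoiding (E - M) S) x) < a * card T"
  proof (rule ccontr)
    assume "\<not> ?thesis"
    then have "\<exists>F\<subseteq>E - M. \<forall>x\<in>V. a \<le> degree F x \<and> degree F x \<le> b"
      using assms(3) by (intro gf_factor_exists[OF GD]) (force simp: mult.commute not_less)+
    then show False using none by (auto simp: has_ab_factor_def is_ab_factor_def)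
  qed
  then obtain S T where SV: "S \<subseteq> V" and TV: "T \<subseteq> V" and ST: "S \<inter> T = {}"
    and viol: "b * card S + (\<Sum>x\<in>T. degree (edges_avoiding (E - M) S) x) < a * card T"
    by blast
  have fS: "finite S" and fT: "finite T" using SV TV fV by (auto intro: finite_subset)
  define d where "d = degree (edges_avoiding E S)"
  define d' where "d' = degree (edges_avoiding (E - M) S)"
  have d_le: "d x \<le> d' x + degree M x" for x
  proof -
    have "d x \<le> degree (edges_avoiding (E - M) S \<union> M) x"
      unfolding d_def using fE fM by (intro degree_mono) (auto simp: edges_avoiding_def)
    then show ?thesis using degree_Un_le d'_def by (metis le_trans)
  qed
  have min_deg: "a + n \<le> d x + card S" if "x \<in> V - S" for x
  proof -
    have "min_degree V E \<le> degree E x" unfolding min_degree_def using that fV by simp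
    then show ?thesis
      using assms(5) degree_le_edges_avoiding[OF G fS, of x] that by (simp add: d_def)
  qed
  define U where "U = {x \<in> T. d x < a}"
  have "b * card S + (\<Sum>x\<in>T. d' x) < (\<Sum>x\<in>T. a)" using viol by (simp add: d'_def mult.commute)
  also have "\<dots> \<le> (\<Sum>x\<in>T. (a - d x) + degree M x + d' x)"
  proof (rule sum_mono)
    fix x show "a \<le> (a - d x) + degree M x + d' x" using d_le[of x] by linarith
  qed
  also have "\<dots> = (\<Sum>x\<in>T. a - d x) + (\<Sum>x\<in>T. degree M x) + (\<Sum>x\<in>T. d' x)"
    by (simp add: sum.distrib)
  also have "(\<Sum>x\<in>T. a - d x) = (\<Sum>x\<in>U. a - d x)"
    by (rule sum.mono_neutral_right[OF fT]) (auto simp: U_def)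
  finally have bS: "b * card S < (\<Sum>x\<in>U. a - d x) + 2 * n"
    using sum_degree_le[OF GM fT] M by simp
  have fU: "finite U" using fT by (simp add: U_def)
  obtain I where IU: "I \<subseteq> U" and indep: "\<forall>x\<in>I. \<forall>y\<in>I. {x, y} \<notin> edges_avoiding E S"
    and greedy: "(\<Sum>x\<in>U. a - d x) \<le> (\<Sum>x\<in>I. (d x + 1) * (a - d x))"
    using weighted_independent_set[OF finite_simple_graph_subset[OF G edges_avoiding_subset] fU,
        of S "\<lambda>x. a - d x"]
    unfolding d_def by blast
  have fI: "finite I" using IU fU by (rule finite_subset)
  have IVS: "I \<subseteq> V - S" and Id: "\<And>x. x \<in> I \<Longrightarrow> d x < a"
    using IU TV ST by (auto simp: U_def)
  have bS': "b * card S < (\<Sum>x\<in>I. (d x + 1) * (a - d x)) + 2 * n" using bS greedy by linarith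
  have "card I = 0 \<or> card I = 1 \<or> 2 \<le> card I" by linarith
  then show False
  proof (elim disjE)
    \<comment> \<open>The violation still provides a vertex with \<open>d' x < a\<close>. The
      matching takes at most one edge there, so \<open>d x \<le> a\<close>, and the minimum degree
      forces \<open>n \<le> card S\<close>; now \<open>b \<ge> 2\<close> contradicts
      \<open>lt\<close>.\<close>
    assume "card I = 0"
    then have lt: "b * card S < 2 * n" using bS' fI by simp
    have "\<exists>x\<in>T. d' x < a"
    proof (rule ccontr)
      assume "\<not> ?thesis"
      then have "(\<Sum>x\<in>T. a) \<le> (\<Sum>x\<in>T. d' x)" by (intro sum_mono) auto
      then show False using viol by (simp add: d'_def mult.commute)
    qed
    then obtain x where x: "x \<in> T" "d' x < a" by blast
    then have "d x \<le> a" using d_le[of x] degree_matching_le[of E M x] M fM by simp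
    then have "n \<le> card S" using min_deg[of x] x TV ST by fastforce
    then have "2 * n \<le> b * card S" using assms(2,3) by (intro mult_le_mono) auto
    then show False using lt by simp
  next
    assume "card I = 1"
    then obtain x where Ix: "I = {x}" by (auto simp: card_1_singleton_iff)
    then have "d x < a" using Id by simp
    moreover have "a + n \<le> d x + card S" using min_deg[of x] Ix IVS by simp
    \<comment> \<open>The two resulting terms dominate \<open>(d x + 1) * (a - d x)\<close> and
      \<open>2 * n\<close> separately, as \<open>d x + 1 \<le> a < b\<close> and
      \<open>b \<ge> 2\<close>.\<close>
    ultimately have "b * (a - d x + n) \<le> b * card S" by (intro mult_left_mono) auto
    then have "b * (a - d x) + b * n \<le> b * card S" by (simp only: distrib_left)
    moreover have "(d x + 1) * (a - d x) \<le> b * (a - d x)"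
      using \<open>d x < a\<close> assms(3) by (intro mult_right_mono) auto
    moreover have "2 * n \<le> b * n" using assms(2,3) by (intro mult_right_mono) auto
    moreover have "b * card S < (d x + 1) * (a - d x) + 2 * n" using bS' Ix by simp
    ultimately show False by linarith
  next
    assume I2: "2 \<le> card I"
    have indepE: "\<forall>x\<in>I. \<forall>y\<in>I. {x, y} \<notin> E"
      using indep IVS by (auto simp: edges_avoiding_def)
    have b0: "real b > 0" using assms(3) by simp
    let ?t = "real a - 1 + (real a + 2 * real n - 1) / real b"
    have "0 \<le> ?t" using assms(2,4) b0 by (intro add_nonneg_nonneg divide_nonneg_pos) auto
    from isolated_toughness_le[OF G SV IVS indepE I2 this assms(6)]
    have "?t * real (card I) \<le> real (card S) + (\<Sum>x\<in>I. real (d x))" by (simp add: d_def)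
    then have "real b * (?t * real (card I)) \<le> real b * (real (card S) + (\<Sum>x\<in>I. real (d x)))"
      using b0 by (intro mult_left_mono) auto
    moreover have "real b * (?t * real (card I)) =
        (real b * (real a - 1) + (real a + 2 * real n - 1)) * real (card I)"
      using b0 by (simp add: field_simps)
    ultimately have tough: "(real b * (real a - 1) + (real a + 2 * real n - 1)) * real (card I)
        - real b * (\<Sum>x\<in>I. real (d x)) \<le> real b * real (card S)"
      by (simp add: algebra_simps)
    \<comment> \<open>Split \<open>(d + 1) * (a - d)\<close> as
      \<open>(d + 1) * (a - 1 - d) + (d + 1)\<close>, then use \<open>d + 1 \<le> b\<close> in the
      product and \<open>d + 1 \<le> a\<close> in the remainder.\<close>
    have term_le: "real ((d x + 1) * (a - d x)) \<le> real b * (real a - 1) + real a - real b * real (d x)"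
      if "x \<in> I" for x
    proof -
      have "(real (d x) + 1) * (real a - 1 - real (d x)) \<le> real b * (real a - 1 - real (d x))"
        using Id[OF that] assms(3) by (intro mult_right_mono) auto
      moreover have "real ((d x + 1) * (a - d x)) = (real (d x) + 1) * (real a - real (d x))"
        unfolding of_nat_mult using Id[OF that] by (simp add: of_nat_diff)
      ultimately show ?thesis using Id[OF that] by (simp add: algebra_simps)
    qed
    have "real b * real (card S) < (\<Sum>x\<in>I. real ((d x + 1) * (a - d x))) + 2 * real n"
      using iffD2[OF of_nat_less_iff[where 'a = real] bS']
      by (simp only: of_nat_add of_nat_mult of_nat_sum of_nat_numeral)
    also have "\<dots> \<le> (\<Sum>x\<in>I. real b * (real a - 1) + real a - real b * real (d x)) + 2 * real n"
      using term_le by (intro add_right_mono sum_mono)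
    also have "\<dots> = (real b * (real a - 1) + real a) * real (card I)
        - real b * (\<Sum>x\<in>I. real (d x)) + 2 * real n"
      by (simp add: sum_subtractf sum.distrib sum_distrib_left algebra_simps)
    \<comment> \<open>Toughness gains \<open>2 * n - 1\<close> for every vertex of \<open>I\<close>,
      while the matching costs \<open>2 * n\<close> only once. Two vertices already give
      \<open>4 * n - 2 < 2 * n\<close>, which fails for \<open>n \<ge> 1\<close>.\<close>
    finally have "(2 * real n - 1) * real (card I) < 2 * real n"
      using tough by (simp add: algebra_simps)
    moreover have "(2 * real n - 1) * 2 \<le> (2 * real n - 1) * real (card I)"
      using I2 assms(4) by (intro mult_left_mono) auto
    ultimately show False using assms(4) by simp
  qed
qed

end
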